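(* Let $A$ be a nonempty finite set of positive integers. Suppose $A$ is cash-periodic, with (least) period $m$, and $X$ is a solution set for $A$. Suppose $(n;d,e)$ is $A$-critical. Let $i_n\in\{0,\dots,m-1\}$ be the residue of $n$ modulo $m$, $b_{n;d,e}=f_A^{I}(n)-1-d$ and $b^\dagger_{n;d,e}=f_A^{II}(n)-1-e$. Then $$W_A^{\rm cash}(n;d,e)=\mathrm{I}\iff (i_n;b_{n;d,e},b^\dagger_{n;d,e})\in X .$$
   Context: $\mathbb{N}=\{0,1,2,\dots\}$; $a_1=\min(A)$. NIM: there are $n$ stones on the board. Players I and II alternate, Player I first; on his turn a player removes $a$ stones for some $a\in A$ not exceeding the number of stones present. A player who cannot move loses. $W_A(n)\in\{\mathrm{I},\mathrm{II}\}$ is the player with a winning strategy. NIM with cash, state $(n;d,e)$ with $n,d,e\in\mathbb{N}$: $n$ stones are on the board, Player I (who moves first) has $d$ dollars and Player II has $e$ dollars. Players alternate. A player removing $a\in A$ stones also loses $a$ dollars, so $a$ may exceed neither the number of stones nor the mover's dollars. A player who cannot move (fewer than $a_1$ stones, or he has fewer than $a_1$ dollars) loses. $W_A^{\rm cash}(n;d,e)\in\{\mathrm{I},\mathrm{II}\}$ is the player with a winning strategy. The functions $f_A^{I},f_A^{II}:\mathbb{N}\to\mathbb{N}$, by simultaneous recursion on $n$ (below, $a$ ranges over elements of $A$ with $a\le n$): - If $0\le n\le a_1-1$: $f_A^{I}(n)=f_A^{II}(n)=0$. - If $n\ge a_1$: $f_A^{II}(n)=\max_a f_A^{I}(n-a)$.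 - If $n\ge a_1$ and $W_A(n)=\mathrm{I}$: $f_A^{I}(n)=\min\{f_A^{II}(n-a)+a : W_A(n-a)=\mathrm{II}\}$. - If $n\ge a_1$ and $W_A(n)=\mathrm{II}$: $f_A^{I}(n)=\min\{f_A^{II}(n-a)+a : f_A^{I}(n-a)=f_A^{II}(n)\}$. With $r\in\{0,\dots,2a_1-1\}$ the residue of $n$ modulo $2a_1$: $g_A^{I}(n)=\frac{n-r}{2}+\min\{r+1,a_1\}$ and $g_A^{II}(n)=\frac{n-r}{2}+\max\{0,r-a_1+1\}$. $(n;d,e)$ is $A$-critical if $g_A^{I}(n)\le d<f_A^{I}(n)$ and $g_A^{II}(n)\le e<f_A^{II}(n)$. For $a\in A$, $a\le n$, let $C_A^{I}(n,a)=f_A^{I}(n)-f_A^{II}(n-a)-a$ and $C_A^{II}(n,a)=f_A^{II}(n)-f_A^{I}(n-a)$. $A$ is cash-periodic with period $m$ if for all $n_1\equiv n_2\pmod m$: $W_A(n_1)=W_A(n_2)$, and for all $a\in A$ with $a\le n_1,n_2$, $C_A^{I}(n_1,a)=C_A^{I}(n_2,a)$ and $C_A^{II}(n_1,a)=C_A^{II}(n_2,a)$. $A$ is cash-periodic if such an $m\geq 1$ exists, and then $m$ denotes the least one. In that case, for $0\le i<m$ and $a\in A$, let $c_A^{I}(i,a)=C_A^{I}(n,a)$ and $c_A^{II}(i,a)=C_A^{II}(n,a)$ for any $n\ge a$ with $n\equiv i\pmod m$ (independent of the choice of $n$). $\mathbf{CS}_A$ is the set of integer triples $(i;b,b^\dagger)$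 with $0\le i<m$ and $b,b^\dagger\ge 0$. A solution set for $A$ is a subset $X\subseteq\mathbf{CS}_A$ such that: - for every $(i;b,b^\dagger)\in X$, putting $(i';b',b^{\dagger\prime})=(i-a_1 \bmod m;\ b^\dagger-c_A^{II}(i,a_1),\ b-c_A^{I}(i,a_1))$, one of the following holds: $(i';b',b^{\dagger\prime})\in\mathbf{CS}_A\setminus X$; or $b'\ge0$ and $b^{\dagger\prime}<0$; or $b'<0$, $b^{\dagger\prime}<0$ and $W_A(i')=\mathrm{II}$; - for every $(i;b,b^\dagger)\in\mathbf{CS}_A\setminus X$ and every $a\in A$, putting $(i';b',b^{\dagger\prime})=(i-a\bmod m;\ b^\dagger-c_A^{II}(i,a),\ b-c_A^{I}(i,a))$, one of the following holds: $(i';b',b^{\dagger\prime})\in X$; or $b'<0$ and $b^{\dagger\prime}\ge0$; or $b'<0$, $b^{\dagger\prime}<0$ and $W_A(i')=\mathrm{I}$. *)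

theory Defs
  imports Main
begin

section \<open>Two-player games and winning strategies\<close>

datatype player = Player_I | Player_II

text \<open>
  A game is given by the predicate \<open>legal\<close> telling which finite move sequences can occur, starting
  from the initial position.  Player I makes the moves at even positions of the sequence, Player II
  those at odd positions.  A strategy is a function from histories to moves.
\<close>

definition to_move :: "'a list \<Rightarrow> player" where
  "to_move h = (if even (length h) then Player_I else Player_II)"

definition can_move :: "('a list \<Rightarrow> bool) \<Rightarrow> 'a list \<Rightarrow> bool" where
  "can_move legal h \<longleftrightarrow> (\<exists>a. legal (h @ [a]))"

definition follows :: "('a list \<Rightarrow> 'a) \<Rightarrow> player \<Rightarrow> 'a list \<Rightarrow> bool" where
  "follows \<sigma> P h \<longleftrightarrow> (\<forall>k<length h. to_move (take k h) = P \<longrightarrow> h ! k = \<sigma> (take k h))"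

text \<open>
  The first conjunct makes \<open>\<sigma>\<close> prescribe a legal move whenever there is one; the second says that
  no play following \<open>\<sigma>\<close> ends with \<open>P\<close> unable to move.  The games below have no infinite plays
  as long as all moves are positive.
\<close>

definition winning_strategy :: "('a list \<Rightarrow> bool) \<Rightarrow> player \<Rightarrow> ('a list \<Rightarrow> 'a) \<Rightarrow> bool" where
  "winning_strategy legal P \<sigma> \<longleftrightarrow>
     (\<forall>h. legal h \<and> follows \<sigma> P h \<and> to_move h = P \<and> can_move legal h \<longrightarrow> legal (h @ [\<sigma> h])) \<and>
     (\<forall>h. legal h \<and> follows \<sigma> P h \<and> \<not> can_move legal h \<longrightarrow> to_move h \<noteq> P)"

definition winner :: "('a list \<Rightarrow> bool) \<Rightarrow> player" where
  "winner legal = (THE P. \<exists>\<sigma>. winning_strategy legal P \<sigma>)"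


section \<open>NIM and NIM with cash\<close>

fun nim_play :: "nat set \<Rightarrow> nat \<Rightarrow> nat list \<Rightarrow> bool" where
  "nim_play A n [] \<longleftrightarrow> True"
| "nim_play A n (a # h) \<longleftrightarrow> a \<in> A \<and> a \<le> n \<and> nim_play A (n - a) h"

text \<open>
  In the cash game \<open>d\<close> always belongs to the player about to move and \<open>e\<close> to the opponent, hence
  the swap after each move.
\<close>

fun cash_play :: "nat set \<Rightarrow> nat \<Rightarrow> nat \<Rightarrow> nat \<Rightarrow> nat list \<Rightarrow> bool" where
  "cash_play A n d e [] \<longleftrightarrow> True"
| "cash_play A n d e (a # h) \<longleftrightarrow>
     a \<in> A \<and> a \<le> n \<and> a \<le> d \<and> cash_play A (n - a) e (d - a) h"

definition W :: "nat set \<Rightarrow> nat \<Rightarrow> player" where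
  "W A n = winner (nim_play A n)"

definition W_cash :: "nat set \<Rightarrow> nat \<Rightarrow> nat \<Rightarrow> nat \<Rightarrow> player" where
  "W_cash A n d e = winner (cash_play A n d e)"


section \<open>The functions f and g, critical states\<close>

text \<open>
  The guard \<open>0 < a\<close> only serves termination; it is void for sets of positive integers.
\<close>

context
  notes conj_cong [fundef_cong] Collect_cong [fundef_cong]
begin

function fI :: "nat set \<Rightarrow> nat \<Rightarrow> nat" and fII :: "nat set \<Rightarrow> nat \<Rightarrow> nat" where
  "fI A n =
     (if n < Min A then 0
      else if W A n = Player_I then
        Min ((\<lambda>a. fII A (n - a) + a) ` {a \<in> A. 0 < a \<and> a \<le> n \<and> W A (n - a) = Player_II})
      else
        Min ((\<lambda>a. fII A (n - a) + a) ` {a \<in> A. 0 < a \<and> a \<le> n \<and> fI A (n - a) = fII A n}))"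
| "fII A n =
     (if n < Min A then 0
      else Max ((\<lambda>a. fI A (n - a)) ` {a \<in> A. 0 < a \<and> a \<le> n}))"
  by pat_completeness auto

termination
  by (relation "measure (case_sum (\<lambda>(A, n). 2 * n + 1) (\<lambda>(A, n). 2 * n))") auto

end

declare fI.simps [simp del] fII.simps [simp del]

definition gI :: "nat set \<Rightarrow> nat \<Rightarrow> nat" where
  "gI A n = (let r = n mod (2 * Min A) in (n - r) div 2 + min (r + 1) (Min A))"

text \<open>Truncated subtraction on natural numbers yields \<open>max {0, r - min A + 1}\<close>.\<close>

definition gII :: "nat set \<Rightarrow> nat \<Rightarrow> nat" where
  "gII A n = (let r = n mod (2 * Min A) in (n - r) div 2 + ((r + 1) - Min A))"

definition critical :: "nat set \<Rightarrow> nat \<Rightarrow> nat \<Rightarrow> nat \<Rightarrow> bool" where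
  "critical A n d e \<longleftrightarrow> gI A n \<le> d \<and> d < fI A n \<and> gII A n \<le> e \<and> e < fII A n"


section \<open>Cash-periodicity and solution sets\<close>

definition CI :: "nat set \<Rightarrow> nat \<Rightarrow> nat \<Rightarrow> int" where
  "CI A n a = int (fI A n) - int (fII A (n - a)) - int a"

definition CII :: "nat set \<Rightarrow> nat \<Rightarrow> nat \<Rightarrow> int" where
  "CII A n a = int (fII A n) - int (fI A (n - a))"

definition cash_periodic_with :: "nat set \<Rightarrow> nat \<Rightarrow> bool" where
  "cash_periodic_with A m \<longleftrightarrow> m \<ge> 1 \<and>
     (\<forall>n1 n2. n1 mod m = n2 mod m \<longrightarrow>
        W A n1 = W A n2 \<and>
        (\<forall>a\<in>A. a \<le> n1 \<and> a \<le> n2 \<longrightarrow> CI A n1 a = CI A n2 a \<and> CII A n1 a = CII A n2 a))"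

definition cash_periodic :: "nat set \<Rightarrow> bool" where
  "cash_periodic A \<longleftrightarrow> (\<exists>m. cash_periodic_with A m)"

definition cash_period :: "nat set \<Rightarrow> nat" where
  "cash_period A = (LEAST m. cash_periodic_with A m)"

definition cI :: "nat set \<Rightarrow> nat \<Rightarrow> nat \<Rightarrow> int" where
  "cI A i a = CI A (SOME n. a \<le> n \<and> n mod cash_period A = i) a"

definition cII :: "nat set \<Rightarrow> nat \<Rightarrow> nat \<Rightarrow> int" where
  "cII A i a = CII A (SOME n. a \<le> n \<and> n mod cash_period A = i) a"

definition CS :: "nat set \<Rightarrow> (nat \<times> int \<times> int) set" where
  "CS A = {(i, b, b'). i < cash_period A \<and> b \<ge> 0 \<and> b' \<ge> 0}"

text \<open>The transition \<open>(i; b, b\<^sup>\<dagger>) \<mapsto> (i'; b', b\<^sup>\<dagger>')\<close> induced by removing \<open>a\<close> stones.\<close>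

definition cs_step :: "nat set \<Rightarrow> nat \<Rightarrow> nat \<times> int \<times> int \<Rightarrow> nat \<times> int \<times> int" where
  "cs_step A a = (\<lambda>(i, b, bd).
     (nat ((int i - int a) mod int (cash_period A)), bd - cII A i a, b - cI A i a))"

definition solution_set :: "nat set \<Rightarrow> (nat \<times> int \<times> int) set \<Rightarrow> bool" where
  "solution_set A X \<longleftrightarrow> X \<subseteq> CS A \<and>
     (\<forall>t\<in>X. case cs_step A (Min A) t of (i', b', bd') \<Rightarrow>
        (i', b', bd') \<in> CS A - X \<or>
        b' \<ge> 0 \<and> bd' < 0 \<or>
        b' < 0 \<and> bd' < 0 \<and> W A i' = Player_II) \<and>
     (\<forall>t\<in>CS A - X. \<forall>a\<in>A. case cs_step A a t of (i', b', bd') \<Rightarrow>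
        (i', b', bd') \<in> X \<or>
        b' < 0 \<and> bd' \<ge> 0 \<or>
        b' < 0 \<and> bd' < 0 \<and> W A i' = Player_I)"

end

theory Submission
  imports Defs
begin

text \<open>
  A critical state is one in which both players are too poor for ordinary NIM strategy
  (cash below \<open>f\<close>) and yet neither has already lost by poverty (cash at least \<open>g\<close>).  The argument
  rests on a description of every other state that a move can lead to.

  Rich states.  If exactly one player has cash at least his value of \<open>f\<close>, that player wins; if both
  do, the ordinary NIM winner wins.  The recursion defining \<open>f\<close> is exactly what makes
  this statement inductive (\<open>rich_states\<close>).

  Poor states.  The functions \<open>g\<close> satisfy \<open>gI (n + a\<^sub>1) = gII n + a\<^sub>1\<close>,
  \<open>gII (n + a\<^sub>1) = gI n\<close> and \<open>gI n + gII n = n + 1\<close>, and \<open>gI\<close> is monotone.  So a player who has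
  his \<open>g\<close> against an opponent who has not keeps this advantage by always removing the least
  element \<open>a\<^sub>1\<close>, and no move of the opponent destroys it (\<open>poor_states\<close>).

  Critical states.  Write \<open>b = fI n - 1 - d\<close> and \<open>b' = fII n - 1 - e\<close> for the deficits.  The numbers
  \<open>CI\<close> and \<open>CII\<close> are chosen such that removing \<open>a\<close> stones changes the deficits by \<open>cs_step\<close>, and a
  negative deficit means a rich player.  Hence the clauses of a solution set say that from a state
  in \<open>X\<close> the removal of \<open>a\<^sub>1\<close> leads to a loss for the next player, and that from a state outside \<open>X\<close>
  every move leads to a win for the next player: the clauses with a negative deficit are settled
  by the rich states.  When both deficits stay non-negative, the removal of \<open>a\<^sub>1\<close> preserves both
  lower bounds by \<open>g\<close>, so the new state is critical again and induction applies;
  any other move preserves the lower bound for the opponent, so that the new state is either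
  critical or a poor state won by the opponent.
\<close>

section \<open>Recursive computation of the winner\<close>

definition has_winning_strategy :: "('a list \<Rightarrow> bool) \<Rightarrow> player \<Rightarrow> bool" where
  "has_winning_strategy legal P \<longleftrightarrow> (\<exists>\<sigma>. winning_strategy legal P \<sigma>)"

fun opponent :: "player \<Rightarrow> player" where
  "opponent Player_I = Player_II"
| "opponent Player_II = Player_I"

lemma not_Player_I_iff: "P \<noteq> Player_I \<longleftrightarrow> P = Player_II"
  by (cases P) auto

lemma to_move_Nil: "to_move [] = Player_I"
  by (simp add: to_move_def)

lemma to_move_Cons: "to_move (a # h) = opponent (to_move h)"
  by (simp add: to_move_def)

lemma can_move_Cons: "can_move legal (a # h) \<longleftrightarrow> can_move (\<lambda>h. legal (a # h)) h"
  by (simp add: can_move_def)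

lemma follows_Nil: "follows \<sigma> P []"
  by (simp add: follows_def)

lemma follows_Cons:
  "follows \<sigma> P (a # h) \<longleftrightarrow>
     (P = Player_I \<longrightarrow> a = \<sigma> []) \<and> follows (\<lambda>h. \<sigma> (a # h)) (opponent P) h"
proof -
  have eq: "to_move (a # t) = P \<longleftrightarrow> to_move t = opponent P" for t :: "'a list"
    by (cases P; cases "to_move t") (auto simp: to_move_Cons)
  show ?thesis
    unfolding follows_def
    by (auto simp: All_less_Suc2 eq to_move_Nil)
qed

text \<open>
  The first move of a game turns it into a game in which the roles are exchanged, and a
  strategy splits accordingly into a first move and strategies for the remaining games.
\<close>

lemma winning_strategy_I_iff:
  assumes "legal []"
  shows "winning_strategy legal Player_I \<sigma> \<longleftrightarrow>
    legal [\<sigma> []] \<and> winning_strategy (\<lambda>h. legal (\<sigma> [] # h)) Player_II (\<lambda>h. \<sigma> (\<sigma> [] # h))"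
  (is "?L \<longleftrightarrow> ?R")
proof
  assume L: ?L
  have "can_move legal []"
    using L assms unfolding winning_strategy_def by (metis follows_Nil to_move_Nil)
  then have "legal [\<sigma> []]"
    using L assms unfolding winning_strategy_def
    by (metis follows_Nil to_move_Nil append_Nil)
  moreover have "follows \<sigma> Player_I (\<sigma> [] # h)"
    if "follows (\<lambda>h. \<sigma> (\<sigma> [] # h)) Player_II h" for h
    using that by (simp add: follows_Cons)
  moreover have "to_move (a # h) = Player_I \<longleftrightarrow> to_move h = Player_II" for a :: 'a and h
    by (cases "to_move h") (auto simp: to_move_Cons)
  ultimately show ?R
    using L unfolding winning_strategy_def
    by (metis append_Cons can_move_Cons)
next
  assume R: ?R
  have flip: "to_move (a # h) = Player_I \<longleftrightarrow> to_move h = Player_II" for a :: 'a and h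
    by (cases "to_move h") (auto simp: to_move_Cons)
  show ?L
    unfolding winning_strategy_def
  proof (intro conjI allI impI)
    fix h
    assume h: "legal h \<and> follows \<sigma> Player_I h \<and> to_move h = Player_I \<and> can_move legal h"
    show "legal (h @ [\<sigma> h])"
    proof (cases h)
      case Nil
      then show ?thesis using R by simp
    next
      case (Cons a t)
      then show ?thesis
        using R h unfolding winning_strategy_def
        by (auto simp: follows_Cons flip can_move_Cons)
    qed
  next
    fix h
    assume h: "legal h \<and> follows \<sigma> Player_I h \<and> \<not> can_move legal h"
    show "to_move h \<noteq> Player_I"
    proof (cases h)
      case Nil
      then show ?thesis using R h by (auto simp: can_move_def)
    next
      case (Cons a t)
      then show ?thesis
        using R h unfolding winning_strategy_def
        by (auto simp: follows_Cons flip can_move_Cons)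
    qed
  qed
qed

lemma winning_strategy_II_iff:
  assumes closed: "\<forall>a h. legal (a # h) \<longrightarrow> legal [a]"
  shows "winning_strategy legal Player_II \<sigma> \<longleftrightarrow>
    (\<forall>a. legal [a] \<longrightarrow> winning_strategy (\<lambda>h. legal (a # h)) Player_I (\<lambda>h. \<sigma> (a # h)))"
  (is "?L \<longleftrightarrow> ?R")
proof -
  have flip: "to_move (a # h) = Player_II \<longleftrightarrow> to_move h = Player_I" for a :: 'a and h
    by (cases "to_move h") (auto simp: to_move_Cons)
  show ?thesis
  proof
    assume L: ?L
    show ?R
    proof (intro allI impI)
      fix a assume "legal [a]"
      have "follows \<sigma> Player_II (a # h)" if "follows (\<lambda>h. \<sigma> (a # h)) Player_I h" for h
        using that by (simp add: follows_Cons)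
      then show "winning_strategy (\<lambda>h. legal (a # h)) Player_I (\<lambda>h. \<sigma> (a # h))"
        using L flip unfolding winning_strategy_def
        by (metis append_Cons can_move_Cons)
    qed
  next
    assume R: ?R
    show ?L
      unfolding winning_strategy_def
    proof (intro conjI allI impI)
      fix h
      assume h: "legal h \<and> follows \<sigma> Player_II h \<and> to_move h = Player_II \<and> can_move legal h"
      then obtain a t where "h = a # t"
        by (cases h) (auto simp: to_move_Nil)
      moreover from this have "legal [a]"
        using h closed by blast
      ultimately show "legal (h @ [\<sigma> h])"
        using R h unfolding winning_strategy_def
        by (auto simp: follows_Cons flip can_move_Cons)
    next
      fix h
      assume h: "legal h \<and> follows \<sigma> Player_II h \<and> \<not> can_move legal h"
      show "to_move h \<noteq> Player_II"
      proof (cases h)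
        case Nil
        then show ?thesis by (simp add: to_move_Nil)
      next
        case (Cons a t)
        moreover from this have "legal [a]"
          using h closed by blast
        ultimately show ?thesis
          using R h unfolding winning_strategy_def
          by (auto simp: follows_Cons flip can_move_Cons)
      qed
    qed
  qed
qed

lemma has_winning_strategy_I_iff:
  assumes "legal []"
  shows "has_winning_strategy legal Player_I \<longleftrightarrow>
    (\<exists>a. legal [a] \<and> has_winning_strategy (\<lambda>h. legal (a # h)) Player_II)"
proof
  assume "has_winning_strategy legal Player_I"
  then obtain \<sigma> where "winning_strategy legal Player_I \<sigma>"
    unfolding has_winning_strategy_def ..
  then have "legal [\<sigma> []]"
    and "winning_strategy (\<lambda>h. legal (\<sigma> [] # h)) Player_II (\<lambda>h. \<sigma> (\<sigma> [] # h))"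
    using winning_strategy_I_iff[of legal, OF assms] by simp_all
  then show "\<exists>a. legal [a] \<and> has_winning_strategy (\<lambda>h. legal (a # h)) Player_II"
    unfolding has_winning_strategy_def by (intro exI conjI)
next
  assume "\<exists>a. legal [a] \<and> has_winning_strategy (\<lambda>h. legal (a # h)) Player_II"
  then obtain a \<tau> where a: "legal [a]"
    and \<tau>: "winning_strategy (\<lambda>h. legal (a # h)) Player_II \<tau>"
    unfolding has_winning_strategy_def by blast
  define \<sigma> where "\<sigma> h = (case h of [] \<Rightarrow> a | _ # t \<Rightarrow> \<tau> t)" for h
  have "winning_strategy legal Player_I \<sigma>"
    using a \<tau> by (subst winning_strategy_I_iff[of legal, OF assms]) (simp add: \<sigma>_def)
  then show "has_winning_strategy legal Player_I"
    unfolding has_winning_strategy_def by blast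
qed

lemma has_winning_strategy_II_iff:
  assumes closed: "\<forall>a h. legal (a # h) \<longrightarrow> legal [a]"
  shows "has_winning_strategy legal Player_II \<longleftrightarrow>
    (\<forall>a. legal [a] \<longrightarrow> has_winning_strategy (\<lambda>h. legal (a # h)) Player_I)"
proof
  assume "has_winning_strategy legal Player_II"
  then obtain \<sigma> where "winning_strategy legal Player_II \<sigma>"
    unfolding has_winning_strategy_def ..
  then have "winning_strategy (\<lambda>h. legal (a # h)) Player_I (\<lambda>h. \<sigma> (a # h))" if "legal [a]" for a
    using winning_strategy_II_iff[of legal, OF closed] that by simp
  then show "\<forall>a. legal [a] \<longrightarrow> has_winning_strategy (\<lambda>h. legal (a # h)) Player_I"
    unfolding has_winning_strategy_def by (intro allI impI exI)
next
  assume "\<forall>a. legal [a] \<longrightarrow> has_winning_strategy (\<lambda>h. legal (a # h)) Player_I"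
  then obtain \<tau> where
    \<tau>: "\<And>a. legal [a] \<Longrightarrow> winning_strategy (\<lambda>h. legal (a # h)) Player_I (\<tau> a)"
    unfolding has_winning_strategy_def by metis
  \<comment> \<open>Player II never moves at the empty history, so the value there is arbitrary.\<close>
  define \<sigma> where "\<sigma> h = (case h of [] \<Rightarrow> undefined | a # t \<Rightarrow> \<tau> a t)" for h
  have "winning_strategy legal Player_II \<sigma>"
    using \<tau> by (subst winning_strategy_II_iff[of legal, OF closed]) (simp_all add: \<sigma>_def)
  then show "has_winning_strategy legal Player_II"
    unfolding has_winning_strategy_def by blast
qed

definition bounded_game :: "('a list \<Rightarrow> bool) \<Rightarrow> nat \<Rightarrow> bool" where
  "bounded_game legal N \<longleftrightarrow> legal [] \<and> (\<forall>h h'. legal (h @ h') \<longrightarrow> legal h) \<and>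
     (\<forall>h. legal h \<longrightarrow> length h \<le> N)"

lemma bounded_game_closed:
  assumes "bounded_game legal N"
  shows "\<forall>a h. legal (a # h) \<longrightarrow> legal [a]"
  using assms unfolding bounded_game_def by (metis append_Cons append_Nil)

lemma bounded_game_Cons:
  assumes "bounded_game legal N" and "legal [a]"
  shows "bounded_game (\<lambda>h. legal (a # h)) (N - 1)"
  using assms unfolding bounded_game_def by (metis append_Cons diff_Suc_1 diff_le_mono length_Cons)

text \<open>
  Determinacy, by Zermelo's backward induction on the bound for the length of a play.
\<close>

lemma has_winning_strategy_determined:
  assumes "bounded_game legal N"
  shows "has_winning_strategy legal Player_II \<longleftrightarrow> \<not> has_winning_strategy legal Player_I"
  using assms
proof (induction N arbitrary: legal)
  case 0
  then have "legal []" and "\<not> legal [a]" for a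
    unfolding bounded_game_def by auto
  then show ?case
    using has_winning_strategy_I_iff[of legal]
      has_winning_strategy_II_iff[of legal, OF bounded_game_closed[OF 0]]
    by blast
next
  case (Suc N)
  have "legal []"
    using Suc.prems unfolding bounded_game_def by blast
  moreover have "has_winning_strategy (\<lambda>h. legal (a # h)) Player_II \<longleftrightarrow>
      \<not> has_winning_strategy (\<lambda>h. legal (a # h)) Player_I" if "legal [a]" for a
    using Suc.IH bounded_game_Cons[OF Suc.prems that] by simp
  ultimately show ?case
    using has_winning_strategy_I_iff[of legal]
      has_winning_strategy_II_iff[of legal, OF bounded_game_closed[OF Suc.prems]]
    by blast
qed

lemma winner_eq_iff:
  assumes "bounded_game legal N"
  shows "winner legal = P \<longleftrightarrow> has_winning_strategy legal P"
proof -
  note det = has_winning_strategy_determined[OF assms]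
  obtain Q where Q: "has_winning_strategy legal Q"
    and uniq: "\<And>P. has_winning_strategy legal P \<Longrightarrow> P = Q"
  proof (cases "has_winning_strategy legal Player_I")
    case True
    with det have "P = Player_I" if "has_winning_strategy legal P" for P
      using that by (cases P) auto
    with True that show ?thesis by blast
  next
    case False
    with det have "P = Player_II" if "has_winning_strategy legal P" for P
      using that by (cases P) auto
    with False det that show ?thesis by blast
  qed
  have "winner legal = Q"
    unfolding winner_def has_winning_strategy_def[symmetric]
    using Q uniq by (rule the_equality)
  then show ?thesis
    using Q uniq by blast
qed

lemma winner_I_iff:
  assumes "bounded_game legal N"
  shows "winner legal = Player_I \<longleftrightarrow>
    (\<exists>a. legal [a] \<and> winner (\<lambda>h. legal (a # h)) = Player_II)"
proof -
  have "legal []"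
    using assms unfolding bounded_game_def by blast
  then show ?thesis
    using winner_eq_iff[OF assms] winner_eq_iff[OF bounded_game_Cons[OF assms]]
      has_winning_strategy_I_iff[of legal]
    by blast
qed

section \<open>Recursive equations for NIM and NIM with cash\<close>

lemma nim_play_prefix: "nim_play A n (h @ h') \<Longrightarrow> nim_play A n h"
  by (induction h arbitrary: n) auto

lemma cash_play_prefix: "cash_play A n d e (h @ h') \<Longrightarrow> cash_play A n d e h"
  by (induction h arbitrary: n d e) auto

lemma nim_play_length:
  "\<forall>a\<in>A. 0 < a \<Longrightarrow> nim_play A n h \<Longrightarrow> length h \<le> n"
  by (induction h arbitrary: n) fastforce+

lemma cash_play_length:
  "\<forall>a\<in>A. 0 < a \<Longrightarrow> cash_play A n d e h \<Longrightarrow> length h \<le> n"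
  by (induction h arbitrary: n d e) fastforce+

locale subtraction_set =
  fixes A :: "nat set"
  assumes finite_moves: "finite A" and moves_nonempty: "A \<noteq> {}"
    and moves_pos: "\<forall>a\<in>A. 0 < a"
begin

lemma W_I_iff: "W A n = Player_I \<longleftrightarrow> (\<exists>a\<in>A. a \<le> n \<and> W A (n - a) = Player_II)"
proof -
  have "bounded_game (nim_play A n) n"
    unfolding bounded_game_def
    by (auto intro: nim_play_prefix nim_play_length[OF moves_pos])
  then have "W A n = Player_I \<longleftrightarrow>
      (\<exists>a. nim_play A n [a] \<and> winner (\<lambda>h. nim_play A n (a # h)) = Player_II)"
    unfolding W_def by (rule winner_I_iff)
  also have "\<dots> \<longleftrightarrow> (\<exists>a\<in>A. a \<le> n \<and> W A (n - a) = Player_II)"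
    by (auto simp: W_def)
  finally show ?thesis .
qed

lemma W_cash_I_iff:
  "W_cash A n d e = Player_I \<longleftrightarrow>
     (\<exists>a\<in>A. a \<le> n \<and> a \<le> d \<and> W_cash A (n - a) e (d - a) = Player_II)"
proof -
  have "bounded_game (cash_play A n d e) n"
    unfolding bounded_game_def
    by (auto intro: cash_play_prefix cash_play_length[OF moves_pos])
  then have "W_cash A n d e = Player_I \<longleftrightarrow>
      (\<exists>a. cash_play A n d e [a] \<and> winner (\<lambda>h. cash_play A n d e (a # h)) = Player_II)"
    unfolding W_cash_def by (rule winner_I_iff)
  also have "\<dots> \<longleftrightarrow>
      (\<exists>a\<in>A. a \<le> n \<and> a \<le> d \<and> W_cash A (n - a) e (d - a) = Player_II)"
    by (auto simp: W_cash_def)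
  finally show ?thesis .
qed

lemma W_II_iff: "W A n = Player_II \<longleftrightarrow> (\<forall>a\<in>A. a \<le> n \<longrightarrow> W A (n - a) = Player_I)"
  by (auto simp: W_I_iff[of n] not_Player_I_iff[symmetric])

lemma W_cash_II_iff:
  "W_cash A n d e = Player_II \<longleftrightarrow>
     (\<forall>a\<in>A. a \<le> n \<longrightarrow> a \<le> d \<longrightarrow> W_cash A (n - a) e (d - a) = Player_I)"
  by (auto simp: W_cash_I_iff[of n d e] not_Player_I_iff[symmetric])

section \<open>Rich states\<close>

lemma Min_in_moves: "Min A \<in> A" and Min_le_move: "a \<in> A \<Longrightarrow> Min A \<le> a"
  and Min_pos: "0 < Min A"
  using finite_moves moves_nonempty moves_pos by auto

lemma fI_le_fII:
  assumes "a \<in> A" and "a \<le> n"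
  shows "fI A (n - a) \<le> fII A n"
proof -
  have "\<not> n < Min A"
    using assms Min_le_move[of a] by linarith
  then show ?thesis
    using assms moves_pos finite_moves by (subst fII.simps[of A n]) (auto intro!: Max_ge)
qed

lemma fI_winning_le:
  assumes "W A n = Player_I" and "a \<in> A" and "a \<le> n" and "W A (n - a) = Player_II"
  shows "fI A n \<le> fII A (n - a) + a"
proof -
  have "\<not> n < Min A"
    using assms Min_le_move[of a] by linarith
  then show ?thesis
    using assms moves_pos finite_moves by (subst fI.simps) (auto intro!: Min_le)
qed

lemma fI_winning_attained:
  assumes "W A n = Player_I"
  obtains a where "a \<in> A" "a \<le> n" "W A (n - a) = Player_II" "fI A n = fII A (n - a) + a"
proof -
  let ?S = "{a \<in> A. 0 < a \<and> a \<le> n \<and> W A (n - a) = Player_II}"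
  obtain a where a: "a \<in> A" "a \<le> n" "W A (n - a) = Player_II"
    using assms W_I_iff by blast
  then have "\<not> n < Min A"
    using Min_le_move[of a] by linarith
  then have "fI A n = Min ((\<lambda>a. fII A (n - a) + a) ` ?S)"
    using assms by (subst fI.simps) simp
  moreover have "Min ((\<lambda>a. fII A (n - a) + a) ` ?S) \<in> (\<lambda>a. fII A (n - a) + a) ` ?S"
    using a moves_pos finite_moves by (intro Min_in) auto
  ultimately show ?thesis
    using that by auto
qed

lemma fI_losing_attained:
  assumes "W A n = Player_II" and "Min A \<le> n"
  obtains a where "a \<in> A" "a \<le> n" "fI A (n - a) = fII A n" "fI A n = fII A (n - a) + a"
proof -
  let ?S = "{a \<in> A. 0 < a \<and> a \<le> n \<and> fI A (n - a) = fII A n}"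
  let ?M = "{a \<in> A. 0 < a \<and> a \<le> n}"
  have "fII A n = Max ((\<lambda>a. fI A (n - a)) ` ?M)"
    using assms by (subst fII.simps) simp
  moreover have "Max ((\<lambda>a. fI A (n - a)) ` ?M) \<in> (\<lambda>a. fI A (n - a)) ` ?M"
    using Min_in_moves Min_pos assms(2) finite_moves by (intro Max_in) auto
  ultimately have "fII A n \<in> (\<lambda>a. fI A (n - a)) ` ?M"
    by simp
  then have "?S \<noteq> {}"
    by force
  then have "Min ((\<lambda>a. fII A (n - a) + a) ` ?S) \<in> (\<lambda>a. fII A (n - a) + a) ` ?S"
    using finite_moves by (intro Min_in) auto
  moreover have "fI A n = Min ((\<lambda>a. fII A (n - a) + a) ` ?S)"
    using assms by (subst fI.simps) simp
  ultimately show ?thesis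
    using that by auto
qed

text \<open>
  The two parts need each other: a winning move of a rich player leads to a state in
  which the same player is the rich opponent, and conversely.  In the first part a rich player
  in a lost NIM position exploits that his opponent lacks \<open>fII n\<close>: he moves to a
  position at which the maximum defining \<open>fII n\<close> is attained.
\<close>

lemma rich_states:
  shows rich_first_wins:
      "fI A n \<le> d \<Longrightarrow> W A n = Player_I \<or> e < fII A n \<Longrightarrow> W_cash A n d e = Player_I"
    and rich_second_wins:
      "fII A n \<le> e \<Longrightarrow> W A n = Player_II \<or> d < fI A n \<Longrightarrow> W_cash A n d e = Player_II"
proof (induction n arbitrary: d e rule: less_induct)
  case (less n)
  {
    case 1
    \<comment> \<open>In both cases the mover pays exactly \<open>fI n - fII (n - a)\<close>, hence is still rich afterwards.\<close>
    obtain a where a: "a \<in> A" "a \<le> n" "fI A n = fII A (n - a) + a"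
      "W A (n - a) = Player_II \<or> e < fI A (n - a)"
    proof (cases "W A n = Player_I")
      case True
      then show ?thesis
        using that fI_winning_attained by metis
    next
      case False
      with 1 have e: "e < fII A n" and "W A n = Player_II"
        by (auto simp: not_Player_I_iff)
      moreover from e have "Min A \<le> n"
        by (subst (asm) fII.simps) (auto split: if_splits)
      ultimately show ?thesis
        using that fI_losing_attained by metis
    qed
    moreover have "n - a < n"
      using a moves_pos by auto
    ultimately have "W_cash A (n - a) e (d - a) = Player_II"
      using less(2) 1(1) by simp
    then show ?case
      using a 1(1) by (subst W_cash_I_iff) (auto intro!: bexI[of _ a])
  next
    case 2
    show ?case
      unfolding W_cash_II_iff[of n]
    proof (intro ballI impI)
      fix a assume a: "a \<in> A" "a \<le> n" "a \<le> d"
      have "n - a < n"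
        using a moves_pos by auto
      moreover have "fI A (n - a) \<le> e"
        using fI_le_fII[OF a(1,2)] 2(1) by simp
      moreover have "W A (n - a) = Player_I \<or> d - a < fII A (n - a)"
      proof (cases "W A n = Player_II")
        case True
        then show ?thesis
          using a W_II_iff by blast
      next
        case False
        with 2 have "W A n = Player_I" and "d < fI A n"
          using not_Player_I_iff by auto
        then show ?thesis
          using fI_winning_le[of n a] a not_Player_I_iff[of "W A (n - a)"] by fastforce
      qed
      ultimately show "W_cash A (n - a) e (d - a) = Player_I"
        using less(1) by blast
    qed
  }
qed

section \<open>Poor states\<close>

lemma g_div_mod:
  assumes "r < 2 * Min A"
  shows "gI A (2 * Min A * q + r) = Min A * q + min (r + 1) (Min A)"
    and "gII A (2 * Min A * q + r) = Min A * q + (r + 1 - Min A)"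
  using assms by (simp_all add: gI_def gII_def Let_def)

lemma div_mod_double_Min:
  obtains q r where "n = 2 * Min A * q + r" "r < 2 * Min A"
  using Min_pos mult_div_mod_eq[of "2 * Min A" n, symmetric]
  by (metis mod_less_divisor nat_0_less_mult_iff zero_less_numeral)

lemma gI_plus_gII: "gI A n + gII A n = n + 1"
proof -
  obtain q r where "n = 2 * Min A * q + r" "r < 2 * Min A"
    by (rule div_mod_double_Min)
  then show ?thesis
    using g_div_mod[of r q] by auto
qed

text \<open>
  Removing \<open>Min A\<close> stones exchanges the roles of the players, and the two requirements are exchanged
  with them, up to the price of the move.  This is what makes \<open>g\<close> invariant under the cheapest play.
\<close>

lemma gII_add_Min: "gII A (n + Min A) = gI A n"
proof -
  obtain q r where n: "n = 2 * Min A * q + r" and r: "r < 2 * Min A"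
    by (rule div_mod_double_Min)
  show ?thesis
  proof (cases "r < Min A")
    case True
    have eq: "n + Min A = 2 * Min A * q + (r + Min A)"
      using n by simp
    show ?thesis
      unfolding eq using True n g_div_mod(1)[of r q] g_div_mod(2)[of "r + Min A" q] by simp
  next
    case False
    then have eq: "n + Min A = 2 * Min A * (q + 1) + (r - Min A)"
      using n by simp
    show ?thesis
      unfolding eq using False n r g_div_mod(1)[of r q] g_div_mod(2)[of "r - Min A" "q + 1"] by simp
  qed
qed

lemma gI_add_Min: "gI A (n + Min A) = gII A n + Min A"
  using gII_add_Min[of n] gI_plus_gII[of n] gI_plus_gII[of "n + Min A"] by linarith

lemma gI_mono: "n \<le> n' \<Longrightarrow> gI A n \<le> gI A n'"
proof (rule lift_Suc_mono_le[of "gI A"])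
  fix n
  obtain q r where n: "n = 2 * Min A * q + r" and r: "r < 2 * Min A"
    by (rule div_mod_double_Min)
  show "gI A n \<le> gI A (Suc n)"
  proof (cases "Suc r < 2 * Min A")
    case True
    have eq: "Suc n = 2 * Min A * q + Suc r"
      using n by simp
    show ?thesis
      unfolding eq using True n g_div_mod(1)[of r q] g_div_mod(1)[of "Suc r" q] by simp
  next
    case False
    then have eq: "Suc n = 2 * Min A * (q + 1) + 0"
      using n r by simp
    show ?thesis
      unfolding eq using n r Min_pos g_div_mod(1)[of r q] g_div_mod(1)[of 0 "q + 1"] by simp
  qed
qed

lemma gI_diff_le_gII:
  assumes "a \<in> A" and "a \<le> n"
  shows "gI A (n - a) \<le> gII A n"
proof -
  have "gI A (n - a) \<le> gI A (n - Min A)"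
    using Min_le_move[OF assms(1)] by (intro gI_mono) simp
  then show ?thesis
    using gII_add_Min[of "n - Min A"] Min_le_move[OF assms(1)] assms(2) by simp
qed

text \<open>
  Since \<open>gI + gII\<close> grows by exactly one per stone, \<open>gII\<close> grows by at most one per stone.  So a mover
  who removes more stones than necessary pays at least as much as he lowers his later requirement
  \<open>gII\<close>: no move is cheaper than \<open>Min A\<close>, and a player below \<open>gI n\<close> stays too poor.
\<close>

lemma gI_le_gII_diff:
  assumes "a \<in> A" and "a \<le> n"
  shows "gI A n \<le> gII A (n - a) + a"
  using gI_diff_le_gII[OF assms] gI_plus_gII[of n] gI_plus_gII[of "n - a"] assms(2) by linarith

text \<open>
  The player who meets his requirement can always afford the cheapest move, which keeps the
  inequalities for both players with exchanged roles; the other player has no move that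
  restores his own requirement or destroys his opponent's.
\<close>

lemma poor_states:
  shows poor_second_loses:
      "gI A n \<le> d \<Longrightarrow> e < gII A n \<Longrightarrow> W_cash A n d e = Player_I"
    and poor_first_loses:
      "d < gI A n \<Longrightarrow> gII A n \<le> e \<Longrightarrow> W_cash A n d e = Player_II"
proof (induction n arbitrary: d e rule: less_induct)
  case (less n)
  {
    case 1
    have n: "Min A \<le> n"
    proof (rule ccontr)
      assume "\<not> Min A \<le> n"
      then have "gII A n = 0"
        by (simp add: gII_def)
      with 1 show False by simp
    qed
    have "gI A n = gII A (n - Min A) + Min A" "gII A n = gI A (n - Min A)"
      using gI_add_Min[of "n - Min A"] gII_add_Min[of "n - Min A"] n by simp_all
    moreover have "n - Min A < n"
      using n Min_pos by simp
    ultimately have "W_cash A (n - Min A) e (d - Min A) = Player_II" and "Min A \<le> d"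
      using less(2) 1 by simp_all
    then show ?case
      using n Min_in_moves by (subst W_cash_I_iff) blast
  next
    case 2
    show ?case
      unfolding W_cash_II_iff[of n]
    proof (intro ballI impI)
      fix a assume a: "a \<in> A" "a \<le> n" "a \<le> d"
      have "n - a < n"
        using a moves_pos by auto
      moreover have "gI A (n - a) \<le> e" "d - a < gII A (n - a)"
        using gI_diff_le_gII[OF a(1,2)] gI_le_gII_diff[OF a(1,2)] 2 a(3) by linarith+
      ultimately show "W_cash A (n - a) e (d - a) = Player_I"
        using less(1) by blast
    qed
  }
qed

section \<open>Critical states\<close>

definition deficits :: "nat \<Rightarrow> nat \<Rightarrow> nat \<Rightarrow> nat \<times> int \<times> int" where
  "deficits n d e =
     (n mod cash_period A, int (fI A n) - 1 - int d, int (fII A n) - 1 - int e)"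

lemma cash_periodic_with_cash_period:
  "cash_periodic A \<Longrightarrow> cash_periodic_with A (cash_period A)"
  unfolding cash_periodic_def cash_period_def by (auto intro: LeastI)

lemma W_mod_cash_period:
  "cash_periodic A \<Longrightarrow> W A (n mod cash_period A) = W A n"
  using cash_periodic_with_cash_period unfolding cash_periodic_with_def by (metis mod_mod_trivial)

lemma c_mod_cash_period:
  assumes "cash_periodic A" and "a \<in> A" and "a \<le> n"
  shows "cI A (n mod cash_period A) a = CI A n a"
    and "cII A (n mod cash_period A) a = CII A n a"
proof -
  let ?k = "SOME k. a \<le> k \<and> k mod cash_period A = n mod cash_period A"
  have "a \<le> ?k \<and> ?k mod cash_period A = n mod cash_period A"
    by (rule someI[of _ n]) (simp add: assms)
  then have "CI A ?k a = CI A n a \<and> CII A ?k a = CII A n a"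
    using cash_periodic_with_cash_period[OF assms(1)] assms(2,3)
    unfolding cash_periodic_with_def by blast
  then show "cI A (n mod cash_period A) a = CI A n a"
    and "cII A (n mod cash_period A) a = CII A n a"
    by (simp_all add: cI_def cII_def)
qed

text \<open>
  The terms of \<open>CI n a\<close> and \<open>CII n a\<close> are those by which the values of \<open>f\<close> and the mover's cash change,
  so subtracting them turns the deficits before the move into those after it; cash-periodicity
  lets the residue of \<open>n\<close> determine them.
\<close>

lemma cs_step_deficits:
  assumes "cash_periodic A" and "a \<in> A" and "a \<le> n" and "a \<le> d"
  shows "cs_step A a (deficits n d e) = deficits (n - a) e (d - a)"
proof -
  have "(int (n mod cash_period A) - int a) mod int (cash_period A)
      = int ((n - a) mod cash_period A)"
    using assms(3) by (simp add: zmod_int of_nat_diff mod_diff_left_eq)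
  then show ?thesis
    using c_mod_cash_period[OF assms(1-3)] assms(3,4)
    by (simp add: cs_step_def deficits_def CI_def CII_def of_nat_diff)
qed

lemma deficits_in_CS_iff:
  assumes "cash_periodic A"
  shows "deficits n d e \<in> CS A \<longleftrightarrow> d < fI A n \<and> e < fII A n"
proof -
  have "0 < cash_period A"
    using cash_periodic_with_cash_period[OF assms] unfolding cash_periodic_with_def by simp
  then show ?thesis
    by (auto simp: deficits_def CS_def)
qed

text \<open>
  The clauses of a solution set in terms of actual states, with the sign of a
  deficit expressed as a comparison of cash with \<open>f\<close>.  In the new state the opponent is to move, so
  \<open>e\<close> is compared with \<open>fI\<close> and the remaining \<open>d - a\<close> with \<open>fII\<close>.
\<close>

lemma solution_set_moveD:
  assumes "cash_periodic A" and "solution_set A X" and "a \<in> A" and "a \<le> n" and "a \<le> d"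
  shows "deficits n d e \<in> X \<Longrightarrow> a = Min A \<Longrightarrow>
      deficits (n - a) e (d - a) \<in> CS A - X \<or>
      e < fI A (n - a) \<and> fII A (n - a) \<le> d - a \<or>
      fI A (n - a) \<le> e \<and> fII A (n - a) \<le> d - a \<and> W A (n - a) = Player_II"
    and "deficits n d e \<in> CS A - X \<Longrightarrow>
      deficits (n - a) e (d - a) \<in> X \<or>
      fI A (n - a) \<le> e \<and> d - a < fII A (n - a) \<or>
      fI A (n - a) \<le> e \<and> fII A (n - a) \<le> d - a \<and> W A (n - a) = Player_I"
proof -
  note step = cs_step_deficits[OF assms(1,3,4,5), of e]
  let ?T = "deficits (n - a) e (d - a)"
  have T: "?T = ((n - a) mod cash_period A, int (fI A (n - a)) - 1 - int e,
      int (fII A (n - a)) - 1 - int (d - a))"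
    by (simp add: deficits_def)
  have W: "W A ((n - a) mod cash_period A) = W A (n - a)"
    using W_mod_cash_period[OF assms(1)] .
  show "?T \<in> CS A - X \<or> e < fI A (n - a) \<and> fII A (n - a) \<le> d - a \<or>
      fI A (n - a) \<le> e \<and> fII A (n - a) \<le> d - a \<and> W A (n - a) = Player_II"
    if "deficits n d e \<in> X" "a = Min A"
  proof -
    have "\<forall>t\<in>X. case cs_step A a t of (i', b', bd') \<Rightarrow>
        (i', b', bd') \<in> CS A - X \<or> b' \<ge> 0 \<and> bd' < 0 \<or>
        b' < 0 \<and> bd' < 0 \<and> W A i' = Player_II"
      using assms(2) unfolding solution_set_def that(2) by (elim conjE)
    from bspec[OF this that(1)] show ?thesis
      unfolding step T W prod.case by (elim disjE) auto
  qed
  show "?T \<in> X \<or> fI A (n - a) \<le> e \<and> d - a < fII A (n - a) \<or>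
      fI A (n - a) \<le> e \<and> fII A (n - a) \<le> d - a \<and> W A (n - a) = Player_I"
    if "deficits n d e \<in> CS A - X"
  proof -
    have "\<forall>t\<in>CS A - X. \<forall>a\<in>A. case cs_step A a t of (i', b', bd') \<Rightarrow>
        (i', b', bd') \<in> X \<or> b' < 0 \<and> bd' \<ge> 0 \<or>
        b' < 0 \<and> bd' < 0 \<and> W A i' = Player_I"
      using assms(2) unfolding solution_set_def by (elim conjE)
    from bspec[OF bspec[OF this that] assms(3)] show ?thesis
      unfolding step T W prod.case by (elim disjE) auto
  qed
qed

text \<open>
  The two directions are not symmetric.  From \<open>X\<close> a single good move suffices, and \<open>Min A\<close> is
  the one that a critical state can always afford and that keeps both lower bounds by \<open>g\<close>.  From
  outside \<open>X\<close> every move has to be refuted, and the mover may fall below \<open>gII\<close>; then his opponent,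
  who still meets \<open>gI\<close>, wins by poverty.
\<close>

lemma W_cash_critical_iff:
  assumes periodic: "cash_periodic A" and solution: "solution_set A X"
    and crit: "critical A n d e"
  shows "W_cash A n d e = Player_I \<longleftrightarrow> deficits n d e \<in> X"
  using crit
proof (induction n arbitrary: d e rule: less_induct)
  case (less n)
  have crit: "gI A n \<le> d" "d < fI A n" "gII A n \<le> e" "e < fII A n"
    using less.prems unfolding critical_def by auto
  have CS: "deficits n d e \<in> CS A"
    using deficits_in_CS_iff[OF periodic] crit by blast
  have n: "Min A \<le> n"
    using crit(2) by (subst (asm) fI.simps) (auto split: if_splits)
  show ?case
  proof (cases "deficits n d e \<in> X")
    case True
    have g: "gI A n = gII A (n - Min A) + Min A" "gII A n = gI A (n - Min A)"
      using gI_add_Min[of "n - Min A"] gII_add_Min[of "n - Min A"] n by simp_all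
    then have d: "Min A \<le> d"
      using crit(1) by simp
    have IH: "W_cash A (n - Min A) e (d - Min A) = Player_I \<longleftrightarrow>
        deficits (n - Min A) e (d - Min A) \<in> X" if "critical A (n - Min A) e (d - Min A)"
      using less.IH[of "n - Min A"] that n Min_pos by simp
    consider "deficits (n - Min A) e (d - Min A) \<in> CS A - X"
      | "fII A (n - Min A) \<le> d - Min A" "W A (n - Min A) = Player_II \<or> e < fI A (n - Min A)"
      using solution_set_moveD(1)[OF periodic solution Min_in_moves n d True] by blast
    then have "W_cash A (n - Min A) e (d - Min A) = Player_II"
    proof cases
      case 1
      then have "critical A (n - Min A) e (d - Min A)"
        using deficits_in_CS_iff[OF periodic] crit g by (simp add: critical_def)
      then show ?thesis
        using IH 1 not_Player_I_iff by blast
    next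
      case 2
      then show ?thesis
        by (rule rich_second_wins)
    qed
    then show ?thesis
      using True n d Min_in_moves W_cash_I_iff[of n d e] by blast
  next
    case False
    have "W_cash A (n - a) e (d - a) = Player_I" if a: "a \<in> A" "a \<le> n" "a \<le> d" for a
    proof -
      consider "deficits (n - a) e (d - a) \<in> X"
        | "fI A (n - a) \<le> e" "W A (n - a) = Player_I \<or> d - a < fII A (n - a)"
        using solution_set_moveD(2)[OF periodic solution a] CS False by blast
      then show ?thesis
      proof cases
        case 1
        have e: "gI A (n - a) \<le> e"
          using gI_diff_le_gII[OF a(1,2)] crit(3) by simp
        show ?thesis
        proof (cases "gII A (n - a) \<le> d - a")
          case True
          have "deficits (n - a) e (d - a) \<in> CS A"
            using 1 solution unfolding solution_set_def by blast
          then have "critical A (n - a) e (d - a)"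
            using deficits_in_CS_iff[OF periodic] e True by (simp add: critical_def)
          then show ?thesis
            using less.IH[of "n - a"] 1 a moves_pos by auto
        next
          case False
          then show ?thesis
            using poor_second_loses[OF e] by simp
        qed
      next
        case 2
        then show ?thesis
          by (rule rich_first_wins)
      qed
    qed
    then have "W_cash A n d e = Player_II"
      using W_cash_II_iff by blast
    then show ?thesis
      using False by simp
  qed
qed

end

theorem theorem4p8:
  fixes A :: "nat set" and X :: "(nat \<times> int \<times> int) set" and n d e :: nat
  assumes "finite A" and "A \<noteq> {}" and "\<forall>a\<in>A. 0 < a"
    and "cash_periodic A"
    and "solution_set A X"
    and "critical A n d e"
  shows "W_cash A n d e = Player_I \<longleftrightarrow>
    (n mod cash_period A, int (fI A n) - 1 - int d, int (fII A n) - 1 - int e) \<in> X"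
proof -
  interpret subtraction_set A
    using assms(1-3) by unfold_locales
  show ?thesis
    using W_cash_critical_iff[OF assms(4-6)] unfolding deficits_def .
qed

end
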